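(* Let $A$ be a residuated lattice. Then the following are equivalent: (1) $A$ has the Boolean Lifting Property (BLP); (2) the topological space $\mathrm{Spec}(A)$ (with the Stone topology) is strongly zero-dimensional.
   Context: A residuated lattice is an algebra $(A,\vee,\wedge,\odot,\rightarrow,0,1)$ such that $(A,\vee,\wedge,0,1)$ is a bounded lattice (with order $\leq$), $(A,\odot,1)$ is a commutative monoid, and $a\leq b\rightarrow c$ iff $a\odot b\leq c$ for all $a,b,c$. Put $a\leftrightarrow b=(a\rightarrow b)\wedge(b\rightarrow a)$. $\mathcal{B}(A)$ is the set of complemented elements of the bounded lattice $(A,\vee,\wedge,0,1)$. A filter of $A$ is a non-empty subset closed under $\odot$ and upward closed; a filter $F$ is proper if $F\neq A$. For a filter $F$, $x\equiv y\ (\mathrm{mod}\ F)$ iff $x\leftrightarrow y\in F$ is a congruence; $A/F$ is the quotient residuated lattice, $x/F$ the class of $x$, and $\mathcal{B}(A)/F=\{e/F\mid e\in\mathcal{B}(A)\}$. A filter $F$ has BLP iff $\mathcal{B}(A/F)=\mathcal{B}(A)/F$; $A$ has BLP iff every filter of $A$ has BLP. A prime filter is a proper filter $P$ such that $a\vee b\in P$ implies $a\in P$ or $b\in P$. $\mathrm{Spec}(A)$ is the set of prime filters, with the Stone topology, whose open sets are $D(F)=\{P\in\mathrm{Spec}(A)\mid F\nsubseteq P\}$ for $F$ a filter of $A$. A topological space $X$ is strongly zero-dimensional iff for every closed set $T$ and open set $V$ with $T\subseteq V$ there is a clopen set $U$ with $T\subseteq U\subseteq V$. *)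

theory Defs
  imports "HOL-Analysis.Abstract_Topology" "HOL-Algebra.Group"
begin

section \<open>Residuated lattices\<close>

text \<open>The signature extends the one of monoids: the carrier, the product \<open>\<otimes>\<close> and the
  unit \<open>\<one>\<close> (which is also the top element of the lattice) are inherited from
  \<^typ>\<open>'a monoid\<close>.\<close>

record 'a residuated = "'a monoid" +
  rl_join :: "'a \<Rightarrow> 'a \<Rightarrow> 'a" (infixl "\<curlyvee>\<index>" 65)
  rl_meet :: "'a \<Rightarrow> 'a \<Rightarrow> 'a" (infixl "\<curlywedge>\<index>" 68)
  rl_imp  :: "'a \<Rightarrow> 'a \<Rightarrow> 'a" (infixr "\<leadsto>\<index>" 60)
  rl_bot  :: 'a

definition rl_le :: "('a, 'm) residuated_scheme \<Rightarrow> 'a \<Rightarrow> 'a \<Rightarrow> bool" (infix "\<preceq>\<index>" 50)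
  where "a \<preceq>\<^bsub>A\<^esub> b \<longleftrightarrow> a \<curlywedge>\<^bsub>A\<^esub> b = a"

locale residuated_lattice = Group.comm_monoid A
  for A :: "('a, 'm) residuated_scheme" (structure) +
  assumes join_closed: "\<lbrakk>a \<in> carrier A; b \<in> carrier A\<rbrakk> \<Longrightarrow> a \<curlyvee> b \<in> carrier A"
    and meet_closed: "\<lbrakk>a \<in> carrier A; b \<in> carrier A\<rbrakk> \<Longrightarrow> a \<curlywedge> b \<in> carrier A"
    and imp_closed: "\<lbrakk>a \<in> carrier A; b \<in> carrier A\<rbrakk> \<Longrightarrow> a \<leadsto> b \<in> carrier A"
    and bot_closed: "rl_bot A \<in> carrier A"
    and join_comm: "\<lbrakk>a \<in> carrier A; b \<in> carrier A\<rbrakk> \<Longrightarrow> a \<curlyvee> b = b \<curlyvee> a"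
    and meet_comm: "\<lbrakk>a \<in> carrier A; b \<in> carrier A\<rbrakk> \<Longrightarrow> a \<curlywedge> b = b \<curlywedge> a"
    and join_assoc: "\<lbrakk>a \<in> carrier A; b \<in> carrier A; c \<in> carrier A\<rbrakk>
          \<Longrightarrow> (a \<curlyvee> b) \<curlyvee> c = a \<curlyvee> (b \<curlyvee> c)"
    and meet_assoc: "\<lbrakk>a \<in> carrier A; b \<in> carrier A; c \<in> carrier A\<rbrakk>
          \<Longrightarrow> (a \<curlywedge> b) \<curlywedge> c = a \<curlywedge> (b \<curlywedge> c)"
    and join_absorb: "\<lbrakk>a \<in> carrier A; b \<in> carrier A\<rbrakk> \<Longrightarrow> a \<curlyvee> (a \<curlywedge> b) = a"
    and meet_absorb: "\<lbrakk>a \<in> carrier A; b \<in> carrier A\<rbrakk> \<Longrightarrow> a \<curlywedge> (a \<curlyvee> b) = a"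
    and bot_least: "a \<in> carrier A \<Longrightarrow> rl_bot A \<preceq> a"
    and one_greatest: "a \<in> carrier A \<Longrightarrow> a \<preceq> \<one>"
    and residuation: "\<lbrakk>a \<in> carrier A; b \<in> carrier A; c \<in> carrier A\<rbrakk>
          \<Longrightarrow> a \<preceq> b \<leadsto> c \<longleftrightarrow> a \<otimes> b \<preceq> c"

definition rl_iff :: "('a, 'm) residuated_scheme \<Rightarrow> 'a \<Rightarrow> 'a \<Rightarrow> 'a"
  where "rl_iff A a b = (a \<leadsto>\<^bsub>A\<^esub> b) \<curlywedge>\<^bsub>A\<^esub> (b \<leadsto>\<^bsub>A\<^esub> a)"

definition boolean_center :: "('a, 'm) residuated_scheme \<Rightarrow> 'a set"
  where "boolean_center A =
    {e \<in> carrier A. \<exists>f\<in>carrier A. e \<curlyvee>\<^bsub>A\<^esub> f = \<one>\<^bsub>A\<^esub> \<and> e \<curlywedge>\<^bsub>A\<^esub> f = rl_bot A}"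

section \<open>Filters, quotients and the Boolean Lifting Property\<close>

definition rl_filter :: "('a, 'm) residuated_scheme \<Rightarrow> 'a set \<Rightarrow> bool"
  where "rl_filter A F \<longleftrightarrow> F \<subseteq> carrier A \<and> F \<noteq> {} \<and>
    (\<forall>x\<in>F. \<forall>y\<in>F. x \<otimes>\<^bsub>A\<^esub> y \<in> F) \<and>
    (\<forall>x\<in>F. \<forall>y\<in>carrier A. x \<preceq>\<^bsub>A\<^esub> y \<longrightarrow> y \<in> F)"

definition filter_cong :: "('a, 'm) residuated_scheme \<Rightarrow> 'a set \<Rightarrow> ('a \<times> 'a) set"
  where "filter_cong A F = {(x, y). x \<in> carrier A \<and> y \<in> carrier A \<and> rl_iff A x y \<in> F}"

definition rl_class :: "('a, 'm) residuated_scheme \<Rightarrow> 'a set \<Rightarrow> 'a \<Rightarrow> 'a set"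
  where "rl_class A F x = filter_cong A F `` {x}"

text \<open>An operation on the classes is given by the union of the classes of all the results on
  representatives; as \<^const>\<open>filter_cong\<close> is a congruence, this is a single class.\<close>

definition lift_op ::
    "('a, 'm) residuated_scheme \<Rightarrow> 'a set \<Rightarrow> ('a \<Rightarrow> 'a \<Rightarrow> 'a) \<Rightarrow> 'a set \<Rightarrow> 'a set \<Rightarrow> 'a set"
  where "lift_op A F f X Y = (\<Union>x\<in>X. \<Union>y\<in>Y. rl_class A F (f x y))"

definition rl_quotient :: "('a, 'm) residuated_scheme \<Rightarrow> 'a set \<Rightarrow> 'a set residuated"
  where "rl_quotient A F =
    \<lparr>carrier = carrier A // filter_cong A F,
     monoid.mult = lift_op A F (monoid.mult A),
     one = rl_class A F \<one>\<^bsub>A\<^esub>,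
     rl_join = lift_op A F (rl_join A),
     rl_meet = lift_op A F (rl_meet A),
     rl_imp = lift_op A F (rl_imp A),
     rl_bot = rl_class A F (rl_bot A)\<rparr>"

definition filter_has_BLP :: "('a, 'm) residuated_scheme \<Rightarrow> 'a set \<Rightarrow> bool"
  where "filter_has_BLP A F \<longleftrightarrow>
    boolean_center (rl_quotient A F) = rl_class A F ` boolean_center A"

definition has_BLP :: "('a, 'm) residuated_scheme \<Rightarrow> bool"
  where "has_BLP A \<longleftrightarrow> (\<forall>F. rl_filter A F \<longrightarrow> filter_has_BLP A F)"

section \<open>The prime spectrum\<close>

definition prime_filter :: "('a, 'm) residuated_scheme \<Rightarrow> 'a set \<Rightarrow> bool"
  where "prime_filter A P \<longleftrightarrow> rl_filter A P \<and> P \<noteq> carrier A \<and>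
    (\<forall>a\<in>carrier A. \<forall>b\<in>carrier A. a \<curlyvee>\<^bsub>A\<^esub> b \<in> P \<longrightarrow> a \<in> P \<or> b \<in> P)"

definition rl_Spec :: "('a, 'm) residuated_scheme \<Rightarrow> 'a set set"
  where "rl_Spec A = {P. prime_filter A P}"

definition Spec_open :: "('a, 'm) residuated_scheme \<Rightarrow> 'a set \<Rightarrow> 'a set set"
  where "Spec_open A F = {P \<in> rl_Spec A. \<not> F \<subseteq> P}"

definition stone_topology :: "('a, 'm) residuated_scheme \<Rightarrow> 'a set topology"
  where "stone_topology A = topology (\<lambda>U. \<exists>F. rl_filter A F \<and> U = Spec_open A F)"

context residuated_lattice
begin

lemma le_join: "\<lbrakk>a \<in> carrier A; b \<in> carrier A\<rbrakk> \<Longrightarrow> a \<preceq> a \<curlyvee> b"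
  by (simp add: rl_le_def meet_absorb)

lemma one_in_filter: "rl_filter A F \<Longrightarrow> \<one> \<in> F"
  unfolding rl_filter_def using one_greatest one_closed by blast

lemma filter_carrier: "rl_filter A (carrier A)"
  unfolding rl_filter_def using one_closed by auto

lemma filter_Inter:
  assumes "\<F> \<noteq> {}" "\<And>F. F \<in> \<F> \<Longrightarrow> rl_filter A F"
  shows "rl_filter A (\<Inter>\<F>)"
proof -
  have "\<one> \<in> \<Inter>\<F>"
    using assms one_in_filter by blast
  then show ?thesis
    unfolding rl_filter_def
  proof (intro conjI ballI impI)
    show "\<Inter>\<F> \<subseteq> carrier A"
      using assms unfolding rl_filter_def by blast
  next
    fix x y assume "x \<in> \<Inter>\<F>" "y \<in> \<Inter>\<F>"
    then show "x \<otimes> y \<in> \<Inter>\<F>"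
      using assms(2) by (simp add: rl_filter_def)
  next
    fix x y assume "x \<in> \<Inter>\<F>" "y \<in> carrier A" "x \<preceq> y"
    then show "y \<in> \<Inter>\<F>"
      using assms(2) unfolding rl_filter_def by (meson InterE InterI)
  qed auto
qed

lemma Spec_open_Int:
  assumes F: "rl_filter A F" and G: "rl_filter A G"
  shows "Spec_open A F \<inter> Spec_open A G = Spec_open A (F \<inter> G)"
proof
  show "Spec_open A F \<inter> Spec_open A G \<subseteq> Spec_open A (F \<inter> G)"
  proof
    fix P assume P: "P \<in> Spec_open A F \<inter> Spec_open A G"
    then obtain f g where fg: "f \<in> F" "f \<notin> P" "g \<in> G" "g \<notin> P"
      unfolding Spec_open_def by blast
    have car: "f \<in> carrier A" "g \<in> carrier A"
      using fg F G unfolding rl_filter_def by auto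
    have "f \<preceq> f \<curlyvee> g" "g \<preceq> f \<curlyvee> g"
      using car le_join[of f g] le_join[of g f] join_comm[of f g] by auto
    then have "f \<curlyvee> g \<in> F \<inter> G"
      using fg F G join_closed[OF car] by (auto simp: rl_filter_def)
    moreover have "prime_filter A P"
      using P by (simp add: Spec_open_def rl_Spec_def)
    then have "f \<curlyvee> g \<notin> P"
      using fg car by (auto simp: prime_filter_def)
    ultimately show "P \<in> Spec_open A (F \<inter> G)"
      using P unfolding Spec_open_def by blast
  qed
qed (auto simp: Spec_open_def)

lemma istopology_Spec_open: "istopology (\<lambda>U. \<exists>F. rl_filter A F \<and> U = Spec_open A F)"
  unfolding istopology_def
proof (intro conjI allI impI)
  fix U V
  assume "\<exists>F. rl_filter A F \<and> U = Spec_open A F" "\<exists>F. rl_filter A F \<and> V = Spec_open A F"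
  then obtain F G where FG: "rl_filter A F" "U = Spec_open A F" "rl_filter A G" "V = Spec_open A G"
    by blast
  have "rl_filter A (F \<inter> G)"
    using filter_Inter[of "{F, G}"] FG by auto
  then show "\<exists>F. rl_filter A F \<and> U \<inter> V = Spec_open A F"
    using FG Spec_open_Int by blast
next
  fix \<K>
  assume K: "\<forall>U\<in>\<K>. \<exists>F. rl_filter A F \<and> U = Spec_open A F"
  define \<G> where "\<G> = {F. rl_filter A F \<and> Spec_open A F \<in> \<K>}"
  define G where "G = \<Inter>{H. rl_filter A H \<and> \<Union>\<G> \<subseteq> H}"
  have "carrier A \<in> {H. rl_filter A H \<and> \<Union>\<G> \<subseteq> H}"
    using filter_carrier by (auto simp: \<G>_def rl_filter_def)
  then have "rl_filter A G"
    unfolding G_def by (intro filter_Inter) auto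
  have sub: "G \<subseteq> P \<longleftrightarrow> (\<forall>F\<in>\<G>. F \<subseteq> P)" if "P \<in> rl_Spec A" for P
  proof -
    have "rl_filter A P"
      using that by (simp add: rl_Spec_def prime_filter_def)
    then show ?thesis
      unfolding G_def by blast
  qed
  have "\<K> = Spec_open A ` \<G>"
  proof
    show "\<K> \<subseteq> Spec_open A ` \<G>"
    proof
      fix U assume U: "U \<in> \<K>"
      then obtain F where "rl_filter A F" "U = Spec_open A F"
        using K by metis
      with U show "U \<in> Spec_open A ` \<G>"
        by (simp add: \<G>_def)
    qed
  qed (auto simp: \<G>_def)
  then have "\<Union>\<K> = Spec_open A G"
    using sub by (auto simp: Spec_open_def)
  with \<open>rl_filter A G\<close> show "\<exists>F. rl_filter A F \<and> \<Union>\<K> = Spec_open A F"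
    by (intro exI conjI)
qed

lemma openin_stone_topology:
  "openin (stone_topology A) U \<longleftrightarrow> (\<exists>F. rl_filter A F \<and> U = Spec_open A F)"
  unfolding stone_topology_def topology_inverse'[OF istopology_Spec_open] by (rule refl)

lemma topspace_stone_topology: "topspace (stone_topology A) = rl_Spec A"
proof
  have "Spec_open A F \<subseteq> rl_Spec A" for F
    unfolding Spec_open_def by blast
  then show "topspace (stone_topology A) \<subseteq> rl_Spec A"
    unfolding topspace_def openin_stone_topology by blast
  have "\<not> carrier A \<subseteq> P" if "P \<in> rl_Spec A" for P
    using that unfolding rl_Spec_def prime_filter_def rl_filter_def by blast
  then have "rl_Spec A = Spec_open A (carrier A)"
    unfolding Spec_open_def by blast
  then have "openin (stone_topology A) (rl_Spec A)"
    using filter_carrier openin_stone_topology by blast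
  then show "rl_Spec A \<subseteq> topspace (stone_topology A)"
    by (rule openin_subset)
qed

end

definition strongly_zero_dimensional :: "'a topology \<Rightarrow> bool"
  where "strongly_zero_dimensional X \<longleftrightarrow>
    (\<forall>T V. closedin X T \<and> openin X V \<and> T \<subseteq> V \<longrightarrow>
      (\<exists>U. openin X U \<and> closedin X U \<and> T \<subseteq> U \<and> U \<subseteq> V))"

end

theory Submission
  imports Defs
begin

text \<open>The two sides are related through a purely algebraic property: any two filters \<open>F\<close> and \<open>G\<close>
  that contain elements \<open>f \<in> F\<close> and \<open>g \<in> G\<close> with \<open>f \<otimes> g = 0\<close> (call them comaximal) also contain a
  complementary pair \<open>e \<in> F\<close>, \<open>e' \<in> G\<close>.

  On the topological side, a closed set is the set of primes above a filter \<open>F\<close>, and it lies in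
  the open set \<open>D(G)\<close> iff no prime contains both \<open>F\<close> and \<open>G\<close>. By the prime filter theorem
  (\<open>prime_filter_avoiding\<close>) this means that \<open>F\<close> and \<open>G\<close> are comaximal. The same theorem shows that
  the clopen sets are exactly the sets \<open>{P. e \<in> P}\<close> with \<open>e\<close> complemented
  (\<open>clopen_complemented\<close>, \<open>clopen_is_complemented\<close>). So \<open>T \<subseteq> U \<subseteq> V\<close> with \<open>U\<close> clopen translates into
  \<open>e \<in> F\<close> and \<open>e' \<in> G\<close>.

  On the algebraic side, the class of \<open>x\<close> is complemented in \<open>A/H\<close> iff there is a \<open>y\<close> with
  \<open>x \<curlyvee> y \<in> H\<close> and \<open>h \<otimes> (x \<curlywedge> y) = 0\<close> for some \<open>h \<in> H\<close>. If \<open>f \<in> F\<close> and \<open>g \<in> G\<close> satisfy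
  \<open>f \<otimes> g = 0\<close>, then \<open>f\<close> and \<open>g\<close> are complementary modulo \<open>F \<inter> G\<close>, and a Boolean element congruent
  to \<open>f\<close> separates \<open>F\<close> from \<open>G\<close> (\<open>BLP_imp_separation\<close>). Conversely, if \<open>x\<close> and \<open>y\<close> are complementary
  modulo \<open>H\<close>, then the filters generated by \<open>H\<close> together with \<open>x\<close> and by \<open>H\<close> together with \<open>y\<close> are
  comaximal, and a complementary pair separating them lifts the classes of \<open>x\<close> and \<open>y\<close>
  (\<open>separation_imp_BLP\<close>).\<close>

context residuated_lattice
begin

section \<open>Order and product\<close>

lemmas op_closed [simp, intro] = join_closed meet_closed imp_closed bot_closed

lemma le_refl [simp]: "a \<in> carrier A \<Longrightarrow> a \<preceq> a"
  by (metis join_absorb join_closed meet_absorb meet_closed rl_le_def)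

lemma le_trans:
  "\<lbrakk>a \<preceq> b; b \<preceq> c; a \<in> carrier A; b \<in> carrier A; c \<in> carrier A\<rbrakk> \<Longrightarrow> a \<preceq> c"
  by (metis meet_assoc rl_le_def)

lemma le_antisym: "\<lbrakk>a \<preceq> b; b \<preceq> a; a \<in> carrier A; b \<in> carrier A\<rbrakk> \<Longrightarrow> a = b"
  by (metis meet_comm rl_le_def)

lemma le_join2: "\<lbrakk>a \<in> carrier A; b \<in> carrier A\<rbrakk> \<Longrightarrow> b \<preceq> a \<curlyvee> b"
  by (metis join_comm le_join)

lemma le_iff_join: "\<lbrakk>a \<in> carrier A; b \<in> carrier A\<rbrakk> \<Longrightarrow> a \<preceq> b \<longleftrightarrow> a \<curlyvee> b = b"
  by (metis join_absorb join_comm le_join meet_comm rl_le_def)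

lemma join_le_iff:
  "\<lbrakk>a \<in> carrier A; b \<in> carrier A; c \<in> carrier A\<rbrakk> \<Longrightarrow> a \<curlyvee> b \<preceq> c \<longleftrightarrow> a \<preceq> c \<and> b \<preceq> c"
  by (metis join_assoc join_closed le_iff_join le_join le_join2 le_trans)

lemma le_meet_iff:
  "\<lbrakk>a \<in> carrier A; b \<in> carrier A; c \<in> carrier A\<rbrakk> \<Longrightarrow> c \<preceq> a \<curlywedge> b \<longleftrightarrow> c \<preceq> a \<and> c \<preceq> b"
  by (metis le_refl le_trans meet_assoc meet_closed meet_comm rl_le_def)

lemma meet_le:
  assumes "a \<in> carrier A" "b \<in> carrier A"
  shows "a \<curlywedge> b \<preceq> a" "a \<curlywedge> b \<preceq> b"
  using assms le_meet_iff[of a b "a \<curlywedge> b"] by auto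

lemma le_bot_iff: "a \<in> carrier A \<Longrightarrow> a \<preceq> rl_bot A \<longleftrightarrow> a = rl_bot A"
  using bot_least le_antisym by auto

lemma mult_mono:
  assumes "a \<preceq> b" "a \<in> carrier A" "b \<in> carrier A" "c \<in> carrier A"
  shows "c \<otimes> a \<preceq> c \<otimes> b" "a \<otimes> c \<preceq> b \<otimes> c"
proof -
  have "b \<preceq> c \<leadsto> b \<otimes> c"
    using assms by (simp add: residuation)
  then have "a \<preceq> c \<leadsto> b \<otimes> c"
    using assms le_trans[of a b] by simp
  then show "a \<otimes> c \<preceq> b \<otimes> c"
    using assms by (simp add: residuation)
  then show "c \<otimes> a \<preceq> c \<otimes> b"
    using assms by (simp add: m_comm)
qed

lemma mult_le:
  assumes "a \<in> carrier A" "b \<in> carrier A"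
  shows "a \<otimes> b \<preceq> a" "a \<otimes> b \<preceq> b"
  using assms mult_mono(1)[OF one_greatest, of b a] mult_mono(2)[OF one_greatest, of a b] by auto

lemma mult_le_meet: "\<lbrakk>a \<in> carrier A; b \<in> carrier A\<rbrakk> \<Longrightarrow> a \<otimes> b \<preceq> a \<curlywedge> b"
  by (simp add: le_meet_iff mult_le)

text \<open>Multiplication by \<open>a\<close> has the right adjoint \<open>c \<mapsto> (a \<leadsto> c)\<close>, so it preserves joins. In this
  form distributivity is applied to bound products with a join.\<close>

lemma mult_join_le_iff:
  assumes "a \<in> carrier A" "x \<in> carrier A" "y \<in> carrier A" "c \<in> carrier A"
  shows "a \<otimes> (x \<curlyvee> y) \<preceq> c \<longleftrightarrow> a \<otimes> x \<preceq> c \<and> a \<otimes> y \<preceq> c"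
proof -
  have "z \<preceq> a \<leadsto> c \<longleftrightarrow> a \<otimes> z \<preceq> c" if "z \<in> carrier A" for z
    using that assms by (simp add: residuation m_comm)
  then show ?thesis
    using assms by (metis imp_closed join_closed join_le_iff)
qed

lemma meet_eq_bot_imp_mult_eq_bot:
  "\<lbrakk>a \<curlywedge> b = rl_bot A; a \<in> carrier A; b \<in> carrier A\<rbrakk> \<Longrightarrow> a \<otimes> b = rl_bot A"
  by (metis le_bot_iff m_closed mult_le_meet)

text \<open>Distribute over the join: each of \<open>a \<otimes> (a \<curlywedge> b)\<close> and \<open>b \<otimes> (a \<curlywedge> b)\<close> lies below \<open>a \<otimes> b\<close>.
  Hence where the join of \<open>a\<close> and \<open>b\<close> is \<open>\<one>\<close>, product and meet agree, which lets complements be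
  described by products.\<close>

lemma join_mult_meet_le_mult:
  assumes "a \<in> carrier A" "b \<in> carrier A"
  shows "(a \<curlyvee> b) \<otimes> (a \<curlywedge> b) \<preceq> a \<otimes> b"
proof -
  have "(a \<curlywedge> b) \<otimes> a \<preceq> a \<otimes> b"
    using assms mult_mono(1)[OF meet_le(2)[of a b]] by (simp add: m_comm)
  moreover have "(a \<curlywedge> b) \<otimes> b \<preceq> a \<otimes> b"
    using assms mult_mono(2)[OF meet_le(1)[of a b]] by simp
  ultimately have "(a \<curlywedge> b) \<otimes> (a \<curlyvee> b) \<preceq> a \<otimes> b"
    using assms by (simp add: mult_join_le_iff)
  then show ?thesis
    using assms by (simp add: m_comm)
qed

section \<open>Complements\<close>

definition complementary :: "'a \<Rightarrow> 'a \<Rightarrow> bool" where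
  "complementary e f \<longleftrightarrow>
    e \<in> carrier A \<and> f \<in> carrier A \<and> e \<curlyvee> f = \<one> \<and> e \<curlywedge> f = rl_bot A"

lemma boolean_center_iff: "e \<in> boolean_center A \<longleftrightarrow> (\<exists>f. complementary e f)"
  unfolding boolean_center_def complementary_def by auto

lemma complementary_sym: "complementary e f \<Longrightarrow> complementary f e"
  unfolding complementary_def by (simp add: join_comm meet_comm)

lemma complementaryD:
  assumes "complementary e f"
  shows "e \<in> carrier A" "f \<in> carrier A" "e \<curlyvee> f = \<one>" "e \<otimes> f = rl_bot A"
  using assms meet_eq_bot_imp_mult_eq_bot unfolding complementary_def by auto

lemma complementaryI:
  assumes "e \<in> carrier A" "f \<in> carrier A" "e \<curlyvee> f = \<one>" "e \<otimes> f = rl_bot A"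
  shows "complementary e f"
proof -
  have "e \<curlywedge> f \<preceq> rl_bot A"
    using join_mult_meet_le_mult[of e f] assms by simp
  then show ?thesis
    using assms by (simp add: complementary_def le_bot_iff)
qed

text \<open>The complement is the pseudocomplement: multiply \<open>x\<close> by \<open>e \<curlyvee> f = \<one>\<close>.\<close>

lemma le_complement:
  assumes ef: "complementary e f" and x: "x \<in> carrier A" "x \<otimes> e = rl_bot A"
  shows "x \<preceq> f"
proof -
  note ef = complementaryD[OF ef]
  have "x \<otimes> e \<preceq> f" "x \<otimes> f \<preceq> f"
    using ef x bot_least mult_le(2) by auto
  then have "x \<otimes> (e \<curlyvee> f) \<preceq> f"
    using ef(1,2) x by (simp add: mult_join_le_iff)
  then show ?thesis
    using ef x by simp
qed

section \<open>Filters\<close>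

lemma filter_sub: "\<lbrakk>rl_filter A F; x \<in> F\<rbrakk> \<Longrightarrow> x \<in> carrier A"
  unfolding rl_filter_def by auto

lemma filter_mult: "\<lbrakk>rl_filter A F; x \<in> F; y \<in> F\<rbrakk> \<Longrightarrow> x \<otimes> y \<in> F"
  unfolding rl_filter_def by auto

lemma filter_up: "\<lbrakk>rl_filter A F; x \<in> F; x \<preceq> y; y \<in> carrier A\<rbrakk> \<Longrightarrow> y \<in> F"
  unfolding rl_filter_def by auto

lemma filterI:
  assumes "F \<subseteq> carrier A" "x \<in> F" "\<And>x y. \<lbrakk>x \<in> F; y \<in> F\<rbrakk> \<Longrightarrow> x \<otimes> y \<in> F"
    "\<And>x y. \<lbrakk>x \<in> F; y \<in> carrier A; x \<preceq> y\<rbrakk> \<Longrightarrow> y \<in> F"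
  shows "rl_filter A F"
  using assms unfolding rl_filter_def by blast

lemma filter_eq_carrier_iff:
  assumes "rl_filter A F"
  shows "F = carrier A \<longleftrightarrow> rl_bot A \<in> F"
  using assms filter_up[OF assms _ bot_least] filter_sub by auto

lemma filter_one: "rl_filter A {\<one>}"
proof (rule filterI)
  show "y \<in> {\<one>}" if "x \<in> {\<one>}" "y \<in> carrier A" "x \<preceq> y" for x y
    using that le_antisym[OF one_greatest, of y] by simp
qed auto

text \<open>For filters \<open>F\<close> and \<open>G\<close> this says that no proper filter contains both.\<close>

definition comaximal :: "'a set \<Rightarrow> 'a set \<Rightarrow> bool" where
  "comaximal F G \<longleftrightarrow> (\<exists>f\<in>F. \<exists>g\<in>G. f \<otimes> g = rl_bot A)"

text \<open>This is the filter generated by \<open>F\<close> and \<open>x\<close>. In general its elements are bounded by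
  \<open>k \<otimes> x \<otimes> \<dots> \<otimes> x\<close>; the first power of \<open>x\<close> suffices because \<open>x\<close> is idempotent modulo \<open>F\<close>.\<close>

lemma filter_relative_principal:
  assumes F: "rl_filter A F" and x: "x \<in> carrier A" and h: "h \<in> F" "h \<otimes> x \<preceq> x \<otimes> x"
  shows "rl_filter A {z \<in> carrier A. \<exists>k\<in>F. k \<otimes> x \<preceq> z}" (is "rl_filter A ?G")
proof (rule filterI)
  note sub = filter_sub[OF F]
  show "?G \<subseteq> carrier A"
    by auto
  show "x \<in> ?G"
    using x by (auto intro: bexI[OF _ one_in_filter[OF F]])
  show "z \<in> ?G" if "y \<in> ?G" "z \<in> carrier A" "y \<preceq> z" for y z
    using that le_trans[of _ y z] sub x by blast
  fix y z assume "y \<in> ?G" "z \<in> ?G"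
  then obtain k l where
    yz: "y \<in> carrier A" "z \<in> carrier A" "k \<in> F" "l \<in> F" "k \<otimes> x \<preceq> y" "l \<otimes> x \<preceq> z"
    by auto
  note c = sub[OF yz(3)] sub[OF yz(4)] sub[OF h(1)]
  have "(k \<otimes> l) \<otimes> (h \<otimes> x) \<preceq> (k \<otimes> l) \<otimes> (x \<otimes> x)"
    using c x h by (intro mult_mono(1)) auto
  moreover have "(k \<otimes> x) \<otimes> (l \<otimes> x) \<preceq> y \<otimes> (l \<otimes> x)"
    using c x yz by (intro mult_mono(2)) auto
  moreover have "y \<otimes> (l \<otimes> x) \<preceq> y \<otimes> z"
    using c x yz by (intro mult_mono(1)) auto
  ultimately have "(k \<otimes> l \<otimes> h) \<otimes> x \<preceq> y \<otimes> z"
    using c x yz le_trans[of "k \<otimes> l \<otimes> h \<otimes> x" "k \<otimes> x \<otimes> (l \<otimes> x)" "y \<otimes> z"]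
      le_trans[of "k \<otimes> x \<otimes> (l \<otimes> x)" "y \<otimes> (l \<otimes> x)" "y \<otimes> z"] by (simp add: m_ac)
  moreover have "k \<otimes> l \<otimes> h \<in> F"
    using yz h filter_mult[OF F] by auto
  ultimately show "y \<otimes> z \<in> ?G"
    using yz by auto
qed

text \<open>The point is \<open>(y \<curlyvee> v) \<otimes> (z \<curlyvee> v) \<preceq> (y \<otimes> z) \<curlyvee> v\<close>: every term of the expanded product except
  \<open>y \<otimes> z\<close> has a factor \<open>v\<close>. These filters replace the filters generated by an additional element
  in the proof of the prime filter theorem, so no powers occur there.\<close>

lemma filter_join_residual:
  assumes F: "rl_filter A F" and v: "v \<in> carrier A"
  shows "rl_filter A {z \<in> carrier A. z \<curlyvee> v \<in> F}" (is "rl_filter A ?G")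
proof (rule filterI)
  show "?G \<subseteq> carrier A"
    by auto
  show "\<one> \<in> ?G"
    using filter_up[OF F one_in_filter[OF F] le_join] v by auto
  show "z \<in> ?G" if y: "y \<in> ?G" and z: "z \<in> carrier A" "y \<preceq> z" for y z
  proof -
    have "y \<curlyvee> v \<preceq> z \<curlyvee> v"
      using y z v le_trans[of y z "z \<curlyvee> v"] by (simp add: join_le_iff le_join le_join2)
    then show ?thesis
      using y z v filter_up[OF F, of "y \<curlyvee> v"] by auto
  qed
  fix y z assume yz: "y \<in> ?G" "z \<in> ?G"
  have c: "y \<in> carrier A" "z \<in> carrier A"
    using yz by auto
  have v_le: "v \<preceq> y \<otimes> z \<curlyvee> v"
    using c v by (simp add: le_join2)
  have *: "w \<otimes> v \<preceq> y \<otimes> z \<curlyvee> v" "v \<otimes> w \<preceq> y \<otimes> z \<curlyvee> v" if "w \<in> carrier A" for w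
    using that c v le_trans[OF mult_le(2) v_le] le_trans[OF mult_le(1) v_le] by auto
  have "z \<otimes> (y \<curlyvee> v) \<preceq> y \<otimes> z \<curlyvee> v"
    using * c v m_comm[of z y] by (simp add: mult_join_le_iff le_join)
  then have "(y \<curlyvee> v) \<otimes> (z \<curlyvee> v) \<preceq> y \<otimes> z \<curlyvee> v"
    using * c v m_comm[of z "y \<curlyvee> v"] by (simp add: mult_join_le_iff)
  moreover have "(y \<curlyvee> v) \<otimes> (z \<curlyvee> v) \<in> F"
    using yz filter_mult[OF F] by auto
  ultimately show "y \<otimes> z \<in> ?G"
    using filter_up[OF F] c v by auto
qed

lemma filter_product:
  assumes F: "rl_filter A F" and G: "rl_filter A G"
  shows "rl_filter A {z \<in> carrier A. \<exists>f\<in>F. \<exists>g\<in>G. f \<otimes> g \<preceq> z}" (is "rl_filter A ?H")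
proof (rule filterI)
  note sub = filter_sub[OF F] filter_sub[OF G]
  show "?H \<subseteq> carrier A"
    by auto
  show "\<one> \<in> ?H"
    by (auto intro!: bexI[OF _ one_in_filter[OF F]] bexI[OF _ one_in_filter[OF G]])
  show "z \<in> ?H" if "y \<in> ?H" "z \<in> carrier A" "y \<preceq> z" for y z
    using that le_trans[of _ y z] sub m_closed by blast
  fix y z assume "y \<in> ?H" "z \<in> ?H"
  then obtain f g f' g' where yz: "y \<in> carrier A" "z \<in> carrier A"
    and fg: "f \<in> F" "g \<in> G" "f' \<in> F" "g' \<in> G" "f \<otimes> g \<preceq> y" "f' \<otimes> g' \<preceq> z"
    by auto
  note c = sub(1)[OF fg(1)] sub(2)[OF fg(2)] sub(1)[OF fg(3)] sub(2)[OF fg(4)]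
  have "(f \<otimes> g) \<otimes> (f' \<otimes> g') \<preceq> y \<otimes> (f' \<otimes> g')" "y \<otimes> (f' \<otimes> g') \<preceq> y \<otimes> z"
    using c yz fg by (auto intro: mult_mono)
  then have "(f \<otimes> g) \<otimes> (f' \<otimes> g') \<preceq> y \<otimes> z"
    using c yz le_trans by (meson m_closed)
  then have "(f \<otimes> f') \<otimes> (g \<otimes> g') \<preceq> y \<otimes> z"
    using c by (simp add: m_ac)
  then show "y \<otimes> z \<in> ?H"
    using fg yz filter_mult[OF F fg(1,3)] filter_mult[OF G fg(2,4)] by auto
qed

section \<open>Prime filters\<close>

text \<open>A filter \<open>P\<close> that is maximal among the filters above \<open>F\<close> without \<open>a\<close> is prime. Suppose
  \<open>u \<curlyvee> v \<in> P\<close>. The filter \<open>{z. z \<curlyvee> v \<in> P}\<close> contains \<open>P\<close> and \<open>u\<close>, so maximality gives \<open>u \<in> P\<close> unless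
  \<open>a \<curlyvee> v \<in> P\<close>. In that case \<open>{z. z \<curlyvee> a \<in> P}\<close> contains \<open>P\<close> and \<open>v\<close>, but not \<open>a\<close>, since
  \<open>a \<curlyvee> a = a\<close>; so \<open>v \<in> P\<close>.\<close>

lemma prime_filter_avoiding:
  assumes F: "rl_filter A F" and a: "a \<in> carrier A" "a \<notin> F"
  obtains P where "P \<in> rl_Spec A" "F \<subseteq> P" "a \<notin> P"
proof -
  define \<F> where "\<F> = {G. rl_filter A G \<and> F \<subseteq> G \<and> a \<notin> G}"
  have "\<exists>M\<in>\<F>. \<forall>X\<in>\<F>. M \<subseteq> X \<longrightarrow> X = M"
  proof (rule subset_Zorn_nonempty)
    show "\<F> \<noteq> {}"
      using F a by (auto simp: \<F>_def)
    fix \<C> assume C: "\<C> \<noteq> {}" "subset.chain \<F> \<C>"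
    then have filt: "rl_filter A G" "F \<subseteq> G" "a \<notin> G" if "G \<in> \<C>" for G
      using that by (auto simp: subset.chain_def \<F>_def)
    have "rl_filter A (\<Union>\<C>)"
    proof (rule filterI)
      show "\<Union>\<C> \<subseteq> carrier A"
        using filt filter_sub by blast
      show "\<one> \<in> \<Union>\<C>"
        using C filt one_in_filter by blast
      show "z \<in> \<Union>\<C>" if "y \<in> \<Union>\<C>" "z \<in> carrier A" "y \<preceq> z" for y z
        using that filter_up[OF filt(1)] by blast
      fix y z assume "y \<in> \<Union>\<C>" "z \<in> \<Union>\<C>"
      then obtain G where "G \<in> \<C>" "y \<in> G" "z \<in> G"
        using C(2) unfolding subset_chain_def by blast
      then show "y \<otimes> z \<in> \<Union>\<C>"
        using filter_mult[OF filt(1)] by blast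
    qed
    then show "\<Union>\<C> \<in> \<F>"
      using C(1) filt(2,3) unfolding \<F>_def by blast
  qed
  then obtain P where P: "rl_filter A P" "F \<subseteq> P" "a \<notin> P"
    and max: "\<And>G. \<lbrakk>rl_filter A G; P \<subseteq> G; a \<notin> G\<rbrakk> \<Longrightarrow> G = P"
    unfolding \<F>_def by auto
  have "u \<in> P \<or> v \<in> P" if uv: "u \<in> carrier A" "v \<in> carrier A" "u \<curlyvee> v \<in> P" for u v
  proof -
    let ?Q = "\<lambda>w. {z \<in> carrier A. z \<curlyvee> w \<in> P}"
    have Q: "?Q w = P" if w: "w \<in> carrier A" "a \<curlyvee> w \<notin> P" for w
      using w filter_up[OF P(1) _ le_join] filter_sub[OF P(1)]
      by (intro max filter_join_residual P(1)) auto
    show ?thesis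
    proof (cases "a \<curlyvee> v \<in> P")
      case True
      have "a \<curlyvee> a = a"
        using a le_iff_join[of a a] by simp
      then have "?Q a = P"
        using Q[of a] a P(3) by simp
      moreover have "v \<in> ?Q a"
        using True a uv by (simp add: join_comm)
      ultimately show ?thesis
        by auto
    next
      case False
      then show ?thesis
        using Q[of v] uv by auto
    qed
  qed
  then have "P \<in> rl_Spec A"
    using P a by (auto simp: rl_Spec_def prime_filter_def)
  with P that show thesis
    by blast
qed

lemma SpecD:
  assumes "P \<in> rl_Spec A"
  shows "rl_filter A P" "rl_bot A \<notin> P"
    "\<lbrakk>a \<in> carrier A; b \<in> carrier A; a \<curlyvee> b \<in> P\<rbrakk> \<Longrightarrow> a \<in> P \<or> b \<in> P"
  using assms filter_eq_carrier_iff by (auto simp: rl_Spec_def prime_filter_def)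

text \<open>If no product \<open>f \<otimes> g\<close> is \<open>0\<close>, then the join of \<open>F\<close> and \<open>G\<close> in the lattice of filters
  (\<open>filter_product\<close>) is proper and extends to a prime.\<close>

lemma comaximal_iff_no_prime:
  assumes F: "rl_filter A F" and G: "rl_filter A G"
  shows "comaximal F G \<longleftrightarrow> \<not> (\<exists>P\<in>rl_Spec A. F \<subseteq> P \<and> G \<subseteq> P)"
proof
  assume "comaximal F G"
  then show "\<not> (\<exists>P\<in>rl_Spec A. F \<subseteq> P \<and> G \<subseteq> P)"
    unfolding comaximal_def by (metis SpecD(1,2) filter_mult subsetD)
next
  assume no_prime: "\<not> (\<exists>P\<in>rl_Spec A. F \<subseteq> P \<and> G \<subseteq> P)"
  let ?H = "{z \<in> carrier A. \<exists>f\<in>F. \<exists>g\<in>G. f \<otimes> g \<preceq> z}"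
  have "f \<in> ?H" if "f \<in> F" for f
    using that filter_sub[OF F that] by (auto intro!: bexI[OF _ that] bexI[OF _ one_in_filter[OF G]])
  moreover have "g \<in> ?H" if "g \<in> G" for g
    using that filter_sub[OF G that] by (auto intro!: bexI[OF _ that] bexI[OF _ one_in_filter[OF F]])
  ultimately have FG: "F \<subseteq> ?H" "G \<subseteq> ?H"
    by blast+
  have "rl_bot A \<in> ?H"
  proof (rule ccontr)
    assume "rl_bot A \<notin> ?H"
    then obtain P where P: "P \<in> rl_Spec A" "?H \<subseteq> P"
      by (rule prime_filter_avoiding[OF filter_product[OF F G] bot_closed])
    have "F \<subseteq> P" "G \<subseteq> P"
      using FG[THEN subset_trans, OF P(2)] .
    with P(1) no_prime show False
      by simp
  qed
  then show "comaximal F G"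
    using filter_sub[OF F] filter_sub[OF G] by (auto simp: comaximal_def le_bot_iff)
qed

lemma mem_filter_if_mem_primes:
  assumes "rl_filter A F" "a \<in> carrier A" "\<And>P. \<lbrakk>P \<in> rl_Spec A; F \<subseteq> P\<rbrakk> \<Longrightarrow> a \<in> P"
  shows "a \<in> F"
proof (rule ccontr)
  assume "a \<notin> F"
  then obtain P where "P \<in> rl_Spec A" "F \<subseteq> P" "a \<notin> P"
    by (rule prime_filter_avoiding[OF assms(1,2)])
  then show False
    using assms(3) by blast
qed

lemma eq_one_if_mem_primes:
  assumes "a \<in> carrier A" "\<And>P. P \<in> rl_Spec A \<Longrightarrow> a \<in> P"
  shows "a = \<one>"
proof -
  have "a \<in> {\<one>}"
    using assms by (intro mem_filter_if_mem_primes[OF filter_one]) auto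
  then show ?thesis
    by simp
qed

lemma complementary_mem_prime_iff:
  assumes ef: "complementary e f" and P: "P \<in> rl_Spec A"
  shows "e \<in> P \<longleftrightarrow> f \<notin> P"
proof -
  note ef = complementaryD[OF ef]
  note P = SpecD[OF P]
  show ?thesis
    using ef P(2) P(3)[of e f] one_in_filter[OF P(1)] filter_mult[OF P(1), of e f] by auto
qed

section \<open>Separating comaximal filters by a complemented element\<close>

text \<open>Both properties in the theorem are reformulations of this one. It is the algebraic
  content of strong zero-dimensionality, with closed and open sets of primes replaced by the
  filters that define them.\<close>

definition boolean_separation :: bool where
  "boolean_separation \<longleftrightarrow> (\<forall>F G. rl_filter A F \<and> rl_filter A G \<and> comaximal F G \<longrightarrow>
    (\<exists>e\<in>F. \<exists>f\<in>G. complementary e f))"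

section \<open>Separation and clopen sets of the spectrum\<close>

text \<open>A principal up-set is closed under products as soon as its least element is idempotent, and
  \<open>e = e \<otimes> (e \<curlyvee> f) \<preceq> e \<otimes> e\<close>.\<close>

lemma filter_of_complemented:
  assumes ef: "complementary e f"
  shows "rl_filter A {z \<in> carrier A. e \<preceq> z}"
proof -
  note c = complementaryD[OF ef]
  have "e \<otimes> (e \<curlyvee> f) \<preceq> e \<otimes> e"
    using c(1,2,4) bot_least by (simp add: mult_join_le_iff)
  then have "\<one> \<otimes> e \<preceq> e \<otimes> e"
    using c by simp
  then have "rl_filter A {z \<in> carrier A. \<exists>k\<in>{\<one>}. k \<otimes> e \<preceq> z}"
    using filter_relative_principal[OF filter_one] c by blast
  then show ?thesis
    using c by simp
qed

text \<open>A prime contains \<open>f\<close> iff it omits \<open>e\<close>, so this set is the basic open set of the filter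
  generated by \<open>e\<close>.\<close>

lemma openin_complemented:
  assumes ef: "complementary e f"
  shows "openin (stone_topology A) {P \<in> rl_Spec A. f \<in> P}"
proof -
  note c = complementaryD[OF ef]
  have "{z \<in> carrier A. e \<preceq> z} \<subseteq> P \<longleftrightarrow> e \<in> P" if "P \<in> rl_Spec A" for P
    using c filter_up[OF SpecD(1)[OF that]] by auto
  then have "{P \<in> rl_Spec A. f \<in> P} = Spec_open A {z \<in> carrier A. e \<preceq> z}"
    using complementary_mem_prime_iff[OF ef] by (auto simp: Spec_open_def)
  then show ?thesis
    using filter_of_complemented[OF ef] openin_stone_topology by blast
qed

lemma clopen_complemented:
  assumes ef: "complementary e f"
  shows "openin (stone_topology A) {P \<in> rl_Spec A. e \<in> P}"
    "closedin (stone_topology A) {P \<in> rl_Spec A. e \<in> P}"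
proof -
  show "openin (stone_topology A) {P \<in> rl_Spec A. e \<in> P}"
    using complementary_sym[OF ef] by (rule openin_complemented)
  have "rl_Spec A - {P \<in> rl_Spec A. e \<in> P} = {P \<in> rl_Spec A. f \<in> P}"
    using complementary_mem_prime_iff[OF ef] by auto
  then show "closedin (stone_topology A) {P \<in> rl_Spec A. e \<in> P}"
    using openin_complemented[OF ef]
    by (auto simp: closedin_def topspace_stone_topology)
qed

lemma closedin_stone_topology:
  "closedin (stone_topology A) T \<longleftrightarrow> (\<exists>F. rl_filter A F \<and> T = {P \<in> rl_Spec A. F \<subseteq> P})"
proof -
  have "T \<subseteq> rl_Spec A \<and> rl_Spec A - T = Spec_open A F \<longleftrightarrow> T = {P \<in> rl_Spec A. F \<subseteq> P}" for F
    unfolding Spec_open_def by blast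
  then show ?thesis
    unfolding closedin_def topspace_stone_topology openin_stone_topology by metis
qed

lemma closed_subset_open_iff_comaximal:
  assumes "rl_filter A F" "rl_filter A G"
  shows "{P \<in> rl_Spec A. F \<subseteq> P} \<subseteq> Spec_open A G \<longleftrightarrow> comaximal F G"
  using comaximal_iff_no_prime[OF assms] by (auto simp: Spec_open_def)

text \<open>Let \<open>U\<close> be the set of primes not above \<open>H\<close>, and also the set of primes above \<open>K\<close>. No prime is
  above both filters, so \<open>k \<otimes> h = 0\<close> for some \<open>k \<in> K\<close> and \<open>h \<in> H\<close>. Every prime is above one of
  them, so it contains \<open>k \<curlyvee> h\<close>, which is therefore \<open>\<one>\<close>.\<close>

lemma clopen_is_complemented:
  assumes "openin (stone_topology A) U" "closedin (stone_topology A) U"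
  obtains e f where "complementary e f" "U = {P \<in> rl_Spec A. e \<in> P}"
proof -
  obtain H K where HK: "rl_filter A H" "rl_filter A K"
    and U: "U = Spec_open A H" "U = {P \<in> rl_Spec A. K \<subseteq> P}"
    using assms unfolding openin_stone_topology closedin_stone_topology by blast
  have "comaximal K H"
    using closed_subset_open_iff_comaximal[OF HK(2,1)] U by auto
  then obtain k h where hk: "k \<in> K" "h \<in> H" "k \<otimes> h = rl_bot A"
    unfolding comaximal_def by blast
  note c = filter_sub[OF HK(2) hk(1)] filter_sub[OF HK(1) hk(2)]
  have cover: "h \<in> P \<or> k \<in> P" if "P \<in> rl_Spec A" for P
    using U hk that by (auto simp: Spec_open_def)
  have "k \<curlyvee> h \<in> P" if P: "P \<in> rl_Spec A" for P
    using cover[OF P] c filter_up[OF SpecD(1)[OF P]] by (metis join_closed le_join le_join2)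
  then have "k \<curlyvee> h = \<one>"
    using c by (intro eq_one_if_mem_primes) auto
  then have compl: "complementary k h"
    using c hk by (intro complementaryI)
  have "k \<in> P \<longleftrightarrow> P \<in> U" if "P \<in> rl_Spec A" for P
    using complementary_mem_prime_iff[OF compl that] U that hk by (auto simp: Spec_open_def)
  then have "U = {P \<in> rl_Spec A. k \<in> P}"
    using U by auto
  with compl that show thesis
    by blast
qed

lemma subset_complemented_iff:
  assumes "rl_filter A F" "e \<in> carrier A"
  shows "{P \<in> rl_Spec A. F \<subseteq> P} \<subseteq> {P \<in> rl_Spec A. e \<in> P} \<longleftrightarrow> e \<in> F"
  using mem_filter_if_mem_primes[OF assms] by auto

lemma complemented_subset_open_iff:
  assumes G: "rl_filter A G" and ef: "complementary e f"
  shows "{P \<in> rl_Spec A. e \<in> P} \<subseteq> Spec_open A G \<longleftrightarrow> f \<in> G"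
  using subset_complemented_iff[OF G complementaryD(2)[OF ef]] complementary_mem_prime_iff[OF ef]
  by (auto simp: Spec_open_def)

lemma strongly_zero_dimensional_iff_separation:
  "strongly_zero_dimensional (stone_topology A) \<longleftrightarrow> boolean_separation"
proof
  assume szd: "strongly_zero_dimensional (stone_topology A)"
  show boolean_separation
    unfolding boolean_separation_def
  proof (intro allI impI, elim conjE)
    fix F G assume F: "rl_filter A F" and G: "rl_filter A G" and co: "comaximal F G"
    have "closedin (stone_topology A) {P \<in> rl_Spec A. F \<subseteq> P}"
      "openin (stone_topology A) (Spec_open A G)"
      using F G openin_stone_topology closedin_stone_topology by auto
    moreover have "{P \<in> rl_Spec A. F \<subseteq> P} \<subseteq> Spec_open A G"
      using co closed_subset_open_iff_comaximal[OF F G] by simp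
    ultimately obtain U where
      clopen: "openin (stone_topology A) U" "closedin (stone_topology A) U" and
      U: "{P \<in> rl_Spec A. F \<subseteq> P} \<subseteq> U" "U \<subseteq> Spec_open A G"
      using szd[unfolded strongly_zero_dimensional_def, rule_format,
          of "{P \<in> rl_Spec A. F \<subseteq> P}" "Spec_open A G"] by auto
    obtain e f where ef: "complementary e f" "U = {P \<in> rl_Spec A. e \<in> P}"
      using clopen by (rule clopen_is_complemented)
    then have "e \<in> F" "f \<in> G"
      using U subset_complemented_iff[OF F] complemented_subset_open_iff[OF G ef(1)]
        complementaryD(1) by auto
    with ef show "\<exists>e\<in>F. \<exists>f\<in>G. complementary e f"
      by blast
  qed
next
  assume sep: boolean_separation
  show "strongly_zero_dimensional (stone_topology A)"
    unfolding strongly_zero_dimensional_def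
  proof (intro allI impI, elim conjE)
    fix T V assume TV: "closedin (stone_topology A) T" "openin (stone_topology A) V" "T \<subseteq> V"
    obtain F where F: "rl_filter A F" and T: "T = {P \<in> rl_Spec A. F \<subseteq> P}"
      using TV(1) unfolding closedin_stone_topology by blast
    obtain G where G: "rl_filter A G" and V: "V = Spec_open A G"
      using TV(2) unfolding openin_stone_topology by blast
    have "comaximal F G"
      using closed_subset_open_iff_comaximal[OF F G] TV(3) T V by simp
    then obtain e f where ef: "e \<in> F" "f \<in> G" "complementary e f"
      using sep F G unfolding boolean_separation_def by blast
    then have "T \<subseteq> {P \<in> rl_Spec A. e \<in> P}" "{P \<in> rl_Spec A. e \<in> P} \<subseteq> V"
      using T V complemented_subset_open_iff[OF G ef(3)] by auto
    then show "\<exists>U. openin (stone_topology A) U \<and> closedin (stone_topology A) U \<and> T \<subseteq> U \<and> U \<subseteq> V"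
      using clopen_complemented[OF ef(3)] by blast
  qed
qed

section \<open>Boolean elements of quotients\<close>

text \<open>Residuation turns the congruence into bounds on products, where a witness \<open>h\<close> is easily
  combined with others by multiplication; all later computations modulo \<open>F\<close> use this form.\<close>

lemma filter_cong_iff:
  assumes F: "rl_filter A F"
  shows "(x, y) \<in> filter_cong A F \<longleftrightarrow> x \<in> carrier A \<and> y \<in> carrier A \<and>
    (\<exists>h\<in>F. h \<otimes> x \<preceq> y \<and> h \<otimes> y \<preceq> x)"
proof -
  have "rl_iff A x y \<in> F \<longleftrightarrow> (\<exists>h\<in>F. h \<otimes> x \<preceq> y \<and> h \<otimes> y \<preceq> x)"
    if xy: "x \<in> carrier A" "y \<in> carrier A"
  proof -
    have closed: "rl_iff A x y \<in> carrier A"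
      using xy by (simp add: rl_iff_def)
    have "rl_iff A x y \<in> F \<longleftrightarrow> (\<exists>h\<in>F. h \<preceq> rl_iff A x y)"
      using filter_up[OF F _ _ closed] le_refl[OF closed] by blast
    also have "\<dots> \<longleftrightarrow> (\<exists>h\<in>F. h \<otimes> x \<preceq> y \<and> h \<otimes> y \<preceq> x)"
      using xy filter_sub[OF F]
      by (intro bex_cong refl) (simp add: rl_iff_def le_meet_iff residuation)
    finally show ?thesis .
  qed
  then show ?thesis
    by (auto simp: filter_cong_def)
qed

lemma equiv_filter_cong:
  assumes F: "rl_filter A F"
  shows "equiv (carrier A) (filter_cong A F)"
proof (rule equivI)
  show "filter_cong A F \<subseteq> carrier A \<times> carrier A"
    by (auto simp: filter_cong_def)
  show "refl_on (carrier A) (filter_cong A F)"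
    unfolding refl_on_def filter_cong_iff[OF F] by (auto intro: bexI[OF _ one_in_filter[OF F]])
  show "sym (filter_cong A F)"
    unfolding sym_def filter_cong_iff[OF F] by blast
  show "trans (filter_cong A F)"
  proof (rule transI)
    fix x y z assume "(x, y) \<in> filter_cong A F" "(y, z) \<in> filter_cong A F"
    then obtain h k where c: "x \<in> carrier A" "y \<in> carrier A" "z \<in> carrier A"
      and hk: "h \<in> F" "k \<in> F" "h \<otimes> x \<preceq> y" "h \<otimes> y \<preceq> x" "k \<otimes> y \<preceq> z" "k \<otimes> z \<preceq> y"
      unfolding filter_cong_iff[OF F] by blast
    note c' = filter_sub[OF F hk(1)] filter_sub[OF F hk(2)]
    have "k \<otimes> (h \<otimes> x) \<preceq> k \<otimes> y" "h \<otimes> (k \<otimes> z) \<preceq> h \<otimes> y"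
      using c c' hk by (auto intro!: mult_mono(1))
    then have "k \<otimes> (h \<otimes> x) \<preceq> z" "h \<otimes> (k \<otimes> z) \<preceq> x"
      using c c' hk le_trans[of "k \<otimes> (h \<otimes> x)" "k \<otimes> y" z]
        le_trans[of "h \<otimes> (k \<otimes> z)" "h \<otimes> y" x] by auto
    then have "(h \<otimes> k) \<otimes> x \<preceq> z" "(h \<otimes> k) \<otimes> z \<preceq> x"
      using c c' by (auto simp: m_ac)
    then show "(x, z) \<in> filter_cong A F"
      unfolding filter_cong_iff[OF F] using c filter_mult[OF F hk(1,2)] by blast
  qed
qed

lemma filter_cong_join_meet:
  assumes F: "rl_filter A F" and "(x, x') \<in> filter_cong A F" "(y, y') \<in> filter_cong A F"
  shows "(x \<curlyvee> y, x' \<curlyvee> y') \<in> filter_cong A F" "(x \<curlywedge> y, x' \<curlywedge> y') \<in> filter_cong A F"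
proof -
  obtain h k where
    c: "x \<in> carrier A" "x' \<in> carrier A" "y \<in> carrier A" "y' \<in> carrier A"
    and hk: "h \<in> F" "k \<in> F" "h \<otimes> x \<preceq> x'" "h \<otimes> x' \<preceq> x" "k \<otimes> y \<preceq> y'" "k \<otimes> y' \<preceq> y"
    using assms(2,3) unfolding filter_cong_iff[OF F] by blast
  note c' = filter_sub[OF F hk(1)] filter_sub[OF F hk(2)]
  have *: "(h \<otimes> k) \<otimes> a \<preceq> a'" if "h \<otimes> a \<preceq> a' \<or> k \<otimes> a \<preceq> a'" "a \<in> carrier A" "a' \<in> carrier A" for a a'
  proof -
    have "(h \<otimes> k) \<otimes> a \<preceq> h \<otimes> a" "(h \<otimes> k) \<otimes> a \<preceq> k \<otimes> a"
      using that c' by (auto intro!: mult_mono(2) mult_le)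
    then show ?thesis
      using that c' le_trans[of "(h \<otimes> k) \<otimes> a" _ a'] by auto
  qed
  have join: "(h \<otimes> k) \<otimes> (a \<curlyvee> b) \<preceq> a' \<curlyvee> b'" and meet: "(h \<otimes> k) \<otimes> (a \<curlywedge> b) \<preceq> a' \<curlywedge> b'"
    if "h \<otimes> a \<preceq> a'" "k \<otimes> b \<preceq> b'"
      "a \<in> carrier A" "a' \<in> carrier A" "b \<in> carrier A" "b' \<in> carrier A" for a a' b b'
  proof -
    have ab: "(h \<otimes> k) \<otimes> a \<preceq> a'" "(h \<otimes> k) \<otimes> b \<preceq> b'"
      using * that by auto
    show "(h \<otimes> k) \<otimes> (a \<curlyvee> b) \<preceq> a' \<curlyvee> b'"
      using ab that c' le_trans[OF ab(1) le_join] le_trans[OF ab(2) le_join2]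
      by (simp add: mult_join_le_iff)
    have "(h \<otimes> k) \<otimes> (a \<curlywedge> b) \<preceq> (h \<otimes> k) \<otimes> a" "(h \<otimes> k) \<otimes> (a \<curlywedge> b) \<preceq> (h \<otimes> k) \<otimes> b"
      using that c' by (auto intro!: mult_mono(1) meet_le)
    then show "(h \<otimes> k) \<otimes> (a \<curlywedge> b) \<preceq> a' \<curlywedge> b'"
      using ab that c' le_trans[of "(h \<otimes> k) \<otimes> (a \<curlywedge> b)" _ a']
        le_trans[of "(h \<otimes> k) \<otimes> (a \<curlywedge> b)" _ b'] by (auto simp: le_meet_iff)
  qed
  show "(x \<curlyvee> y, x' \<curlyvee> y') \<in> filter_cong A F" "(x \<curlywedge> y, x' \<curlywedge> y') \<in> filter_cong A F"
    unfolding filter_cong_iff[OF F]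
    using c hk join meet filter_mult[OF F hk(1,2)] by blast+
qed

lemma rl_class_eq_iff:
  assumes "rl_filter A F" "x \<in> carrier A" "y \<in> carrier A"
  shows "rl_class A F x = rl_class A F y \<longleftrightarrow> (x, y) \<in> filter_cong A F"
  unfolding rl_class_def using eq_equiv_class_iff[OF equiv_filter_cong] assms by blast

lemma lift_op_class:
  assumes F: "rl_filter A F" and x: "x \<in> carrier A" and y: "y \<in> carrier A"
    and cong: "\<And>x' y'. \<lbrakk>(x, x') \<in> filter_cong A F; (y, y') \<in> filter_cong A F\<rbrakk>
      \<Longrightarrow> (f x y, f x' y') \<in> filter_cong A F"
  shows "lift_op A F f (rl_class A F x) (rl_class A F y) = rl_class A F (f x y)"
proof -
  note E = equiv_filter_cong[OF F]
  have "rl_class A F (f x' y') = rl_class A F (f x y)"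
    if "x' \<in> rl_class A F x" "y' \<in> rl_class A F y" for x' y'
    using that cong equiv_class_eq[OF E] by (fastforce simp: rl_class_def)
  moreover have "x \<in> rl_class A F x" "y \<in> rl_class A F y"
    using equiv_class_self[OF E] x y by (auto simp: rl_class_def)
  ultimately show ?thesis
    unfolding lift_op_def by blast
qed

text \<open>The two conditions say that \<open>x \<curlyvee> y\<close> is congruent to \<open>\<one>\<close> and \<open>x \<curlywedge> y\<close> to \<open>0\<close>. The quotient
  is only ever used through this description.\<close>

lemma class_in_boolean_center_iff:
  assumes F: "rl_filter A F" and x: "x \<in> carrier A"
  shows "rl_class A F x \<in> boolean_center (rl_quotient A F) \<longleftrightarrow>
    (\<exists>y\<in>carrier A. x \<curlyvee> y \<in> F \<and> (\<exists>h\<in>F. h \<otimes> (x \<curlywedge> y) = rl_bot A))"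
proof -
  have carr: "carrier (rl_quotient A F) = rl_class A F ` carrier A"
    unfolding rl_quotient_def quotient_def rl_class_def by auto
  have "rl_class A F x \<curlyvee>\<^bsub>rl_quotient A F\<^esub> rl_class A F y = \<one>\<^bsub>rl_quotient A F\<^esub> \<longleftrightarrow> x \<curlyvee> y \<in> F"
    if y: "y \<in> carrier A" for y
  proof -
    note xy = join_closed[OF x y]
    have "rl_class A F x \<curlyvee>\<^bsub>rl_quotient A F\<^esub> rl_class A F y = rl_class A F (x \<curlyvee> y)"
      using lift_op_class[OF F x y filter_cong_join_meet(1)[OF F]] by (simp add: rl_quotient_def)
    moreover have "(x \<curlyvee> y, \<one>) \<in> filter_cong A F \<longleftrightarrow> (\<exists>h\<in>F. h \<preceq> x \<curlyvee> y)"
    proof -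
      have "h \<otimes> (x \<curlyvee> y) \<preceq> \<one> \<and> h \<otimes> \<one> \<preceq> x \<curlyvee> y \<longleftrightarrow> h \<preceq> x \<curlyvee> y" if "h \<in> F" for h
        using filter_sub[OF F that] xy by (simp add: one_greatest)
      then show ?thesis
        unfolding filter_cong_iff[OF F] using xy by simp
    qed
    moreover have "(\<exists>h\<in>F. h \<preceq> x \<curlyvee> y) \<longleftrightarrow> x \<curlyvee> y \<in> F"
      using filter_up[OF F _ _ xy] le_refl[OF xy] by blast
    ultimately show ?thesis
      using rl_class_eq_iff[OF F, of "x \<curlyvee> y" \<one>] x y by (simp add: rl_quotient_def)
  qed
  moreover have "rl_class A F x \<curlywedge>\<^bsub>rl_quotient A F\<^esub> rl_class A F y = rl_bot (rl_quotient A F) \<longleftrightarrow>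
      (\<exists>h\<in>F. h \<otimes> (x \<curlywedge> y) = rl_bot A)"
    if y: "y \<in> carrier A" for y
  proof -
    note xy = meet_closed[OF x y]
    have "rl_class A F x \<curlywedge>\<^bsub>rl_quotient A F\<^esub> rl_class A F y = rl_class A F (x \<curlywedge> y)"
      using lift_op_class[OF F x y filter_cong_join_meet(2)[OF F]] by (simp add: rl_quotient_def)
    moreover have "(x \<curlywedge> y, rl_bot A) \<in> filter_cong A F \<longleftrightarrow>
        (\<exists>h\<in>F. h \<otimes> (x \<curlywedge> y) = rl_bot A)"
    proof -
      have "h \<otimes> (x \<curlywedge> y) \<preceq> rl_bot A \<and> h \<otimes> rl_bot A \<preceq> x \<curlywedge> y \<longleftrightarrow>
          h \<otimes> (x \<curlywedge> y) = rl_bot A" if "h \<in> F" for h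
      proof -
        note hc = filter_sub[OF F that]
        have "h \<otimes> rl_bot A = rl_bot A"
          using mult_le(2)[OF hc bot_closed] hc le_bot_iff by simp
        then show ?thesis
          using hc xy bot_least le_bot_iff by simp
      qed
      then show ?thesis
        unfolding filter_cong_iff[OF F] using xy by simp
    qed
    ultimately show ?thesis
      using rl_class_eq_iff[OF F, of "x \<curlywedge> y" "rl_bot A"] x y by (simp add: rl_quotient_def)
  qed
  ultimately show ?thesis
    using x unfolding boolean_center_def carr by auto
qed

text \<open>Classes of complemented elements are always complemented, so the lifting property is the
  other inclusion.\<close>

lemma filter_has_BLP_iff:
  assumes F: "rl_filter A F"
  shows "filter_has_BLP A F \<longleftrightarrow>
    (\<forall>x\<in>carrier A. \<forall>y\<in>carrier A. x \<curlyvee> y \<in> F \<longrightarrow> (\<exists>h\<in>F. h \<otimes> (x \<curlywedge> y) = rl_bot A) \<longrightarrow>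
      (\<exists>e\<in>boolean_center A. (x, e) \<in> filter_cong A F))" (is "_ \<longleftrightarrow> ?lift")
proof -
  let ?B = "boolean_center (rl_quotient A F)" and ?C = "rl_class A F ` boolean_center A"
  have center: "e \<in> carrier A" if "e \<in> boolean_center A" for e
    using that by (auto simp: boolean_center_def)
  have "rl_class A F e \<in> ?B" if e: "e \<in> boolean_center A" for e
  proof -
    obtain f where f: "f \<in> carrier A" "e \<curlyvee> f = \<one>" "e \<curlywedge> f = rl_bot A"
      using e unfolding boolean_center_iff complementary_def by blast
    then show ?thesis
      unfolding class_in_boolean_center_iff[OF F center[OF e]]
      using one_in_filter[OF F] by (intro bexI[OF _ f(1)] conjI bexI[of _ \<one>]) auto
  qed
  then have "filter_has_BLP A F \<longleftrightarrow> ?B \<subseteq> ?C"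
    unfolding filter_has_BLP_def by blast
  also have "\<dots> \<longleftrightarrow> (\<forall>x\<in>carrier A. rl_class A F x \<in> ?B \<longrightarrow> rl_class A F x \<in> ?C)"
  proof -
    have "?B \<subseteq> rl_class A F ` carrier A"
      unfolding boolean_center_def rl_quotient_def quotient_def rl_class_def by auto
    then show ?thesis
      by blast
  qed
  also have "\<dots> \<longleftrightarrow> (\<forall>x\<in>carrier A. rl_class A F x \<in> ?B \<longrightarrow>
      (\<exists>e\<in>boolean_center A. (x, e) \<in> filter_cong A F))"
    using rl_class_eq_iff[OF F] center by (auto simp: image_iff)
  also have "\<dots> \<longleftrightarrow> ?lift"
    by (intro ball_cong refl) (auto simp: class_in_boolean_center_iff[OF F])
  finally show ?thesis .
qed

section \<open>Separation and the lifting property\<close>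

text \<open>If \<open>f \<otimes> g = 0\<close>, then \<open>f\<close> and \<open>g\<close> are complementary modulo \<open>F \<inter> G\<close>: the join is above both,
  and it annihilates the meet. Let \<open>e\<close> be a Boolean element congruent to \<open>f\<close>, witnessed by
  \<open>h \<in> F \<inter> G\<close>. Then \<open>h \<otimes> f \<preceq> e\<close> puts \<open>e\<close> into \<open>F\<close>, and \<open>h \<otimes> e \<preceq> f\<close> shows that \<open>h \<otimes> g \<in> G\<close>
  annihilates \<open>e\<close>, which puts the complement of \<open>e\<close> into \<open>G\<close>.\<close>

lemma BLP_imp_separation:
  assumes "has_BLP A"
  shows boolean_separation
  unfolding boolean_separation_def
proof (intro allI impI, elim conjE)
  fix F G assume F: "rl_filter A F" and G: "rl_filter A G" and "comaximal F G"
  then obtain f g where fg: "f \<in> F" "g \<in> G" "f \<otimes> g = rl_bot A"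
    unfolding comaximal_def by blast
  note c = filter_sub[OF F fg(1)] filter_sub[OF G fg(2)]
  have FG: "rl_filter A (F \<inter> G)"
    using filter_Inter[of "{F, G}"] F G by auto
  have join: "f \<curlyvee> g \<in> F \<inter> G"
    using filter_up[OF F fg(1) le_join] filter_up[OF G fg(2) le_join2] c by auto
  have "(f \<curlyvee> g) \<otimes> (f \<curlywedge> g) = rl_bot A"
    using join_mult_meet_le_mult[OF c] c fg by (simp add: le_bot_iff)
  then obtain e where e: "e \<in> boolean_center A" "(f, e) \<in> filter_cong A (F \<inter> G)"
    using assms FG join c filter_has_BLP_iff[OF FG] unfolding has_BLP_def by blast
  then obtain h where h: "h \<in> F" "h \<in> G" "h \<otimes> f \<preceq> e" "h \<otimes> e \<preceq> f"
    unfolding filter_cong_iff[OF FG] by blast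
  obtain e' where ee': "complementary e e'"
    using e boolean_center_iff by blast
  note c = c complementaryD(1,2)[OF ee'] filter_sub[OF F h(1)]
  have "e \<in> F"
    using filter_up[OF F filter_mult[OF F h(1) fg(1)] h(3)] c by simp
  moreover have "e' \<in> G"
  proof -
    have "g \<otimes> (h \<otimes> e) \<preceq> g \<otimes> f"
      using c h by (intro mult_mono(1)) auto
    then have "(h \<otimes> g) \<otimes> e = rl_bot A"
      using c fg by (simp add: m_ac le_bot_iff)
    then have "h \<otimes> g \<preceq> e'"
      using c le_complement[OF ee'] by simp
    then show ?thesis
      using filter_up[OF G filter_mult[OF G h(2) fg(2)]] c by simp
  qed
  ultimately show "\<exists>e\<in>F. \<exists>f\<in>G. complementary e f"
    using ee' by blast
qed

text \<open>If \<open>h\<close> and \<open>x \<curlyvee> y\<close> belong to a filter, this says that \<open>x\<close> is idempotent modulo the filter.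
  It is the usual computation \<open>x = x \<otimes> (x \<curlyvee> y) = (x \<otimes> x) \<curlyvee> (x \<otimes> y) = x \<otimes> x\<close> in the quotient.\<close>

lemma relative_complement_idempotent:
  assumes c: "x \<in> carrier A" "y \<in> carrier A" "h \<in> carrier A" and h: "h \<otimes> (x \<curlywedge> y) = rl_bot A"
  shows "(h \<otimes> (x \<curlyvee> y)) \<otimes> x \<preceq> x \<otimes> x"
proof -
  have "h \<otimes> (x \<otimes> y) \<preceq> rl_bot A"
    using mult_mono(1)[OF mult_le_meet[of x y], of h] c h by simp
  then have "h \<otimes> (x \<otimes> y) = rl_bot A"
    using c by (simp add: le_bot_iff)
  then have "(h \<otimes> x) \<otimes> x \<preceq> x \<otimes> x" "(h \<otimes> x) \<otimes> y \<preceq> x \<otimes> x"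
    using c bot_least mult_le(2)[of h "x \<otimes> x"] by (simp_all add: m_assoc)
  then have "(h \<otimes> x) \<otimes> (x \<curlyvee> y) \<preceq> x \<otimes> x"
    using c by (simp add: mult_join_le_iff)
  then show ?thesis
    using c by (simp add: m_ac)
qed

text \<open>Let \<open>x\<close> and \<open>y\<close> be complementary modulo \<open>H\<close>, and let \<open>F\<close> and \<open>G\<close> be the filters generated by
  \<open>H\<close> together with \<open>x\<close> and \<open>y\<close>, respectively. A complementary pair \<open>e \<in> F\<close>, \<open>e' \<in> G\<close> satisfies
  \<open>x \<preceq> e\<close> and \<open>y \<preceq> e'\<close> modulo \<open>H\<close>. The second inequality gives the converse \<open>e \<preceq> x\<close> of the first
  one, since modulo \<open>H\<close> the identity \<open>e = (e \<otimes> x) \<curlyvee> (e \<otimes> y)\<close> holds, and \<open>e \<otimes> y \<preceq> e \<otimes> e' = 0\<close>.\<close>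

lemma separation_imp_BLP:
  assumes sep: boolean_separation
  shows "has_BLP A"
  unfolding has_BLP_def
proof (intro allI impI)
  fix H assume H: "rl_filter A H"
  have "\<exists>e\<in>boolean_center A. (x, e) \<in> filter_cong A H"
    if x: "x \<in> carrier A" and y: "y \<in> carrier A" and xy: "x \<curlyvee> y \<in> H"
      and h: "h \<in> H" "h \<otimes> (x \<curlywedge> y) = rl_bot A" for x y h
  proof -
    note hc = filter_sub[OF H h(1)]
    have hxy: "h \<otimes> (x \<curlyvee> y) \<in> H"
      using filter_mult[OF H h(1) xy] .
    define F where "F = {z \<in> carrier A. \<exists>k\<in>H. k \<otimes> x \<preceq> z}"
    define G where "G = {z \<in> carrier A. \<exists>k\<in>H. k \<otimes> y \<preceq> z}"
    have F: "rl_filter A F"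
      unfolding F_def using relative_complement_idempotent[OF x y hc h(2)]
      by (rule filter_relative_principal[OF H x hxy])
    have "(h \<otimes> (x \<curlyvee> y)) \<otimes> y \<preceq> y \<otimes> y"
      using relative_complement_idempotent[OF y x hc] h(2) x y
      by (simp add: join_comm meet_comm)
    then have G: "rl_filter A G"
      unfolding G_def by (rule filter_relative_principal[OF H y hxy])
    have "h \<otimes> x \<otimes> y \<preceq> rl_bot A"
      using mult_mono(1)[OF mult_le_meet[of x y], of h] x y hc h(2) by (simp add: m_assoc)
    then have "h \<otimes> x \<otimes> y = rl_bot A"
      using x y hc by (simp add: le_bot_iff)
    moreover have "h \<otimes> x \<in> F" "y \<in> G"
      unfolding F_def G_def using x y hc
      by (auto intro: bexI[OF _ h(1)] bexI[OF _ one_in_filter[OF H]])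
    ultimately have "comaximal F G"
      unfolding comaximal_def by blast
    then obtain e e' where e: "e \<in> F" "e' \<in> G" and ee': "complementary e e'"
      using sep F G unfolding boolean_separation_def by blast
    then obtain k l where kl: "k \<in> H" "k \<otimes> x \<preceq> e" "l \<in> H" "l \<otimes> y \<preceq> e'"
      unfolding F_def G_def by blast
    note c = complementaryD(1,2)[OF ee'] filter_sub[OF H kl(1)] filter_sub[OF H kl(3)]
    have "e \<otimes> (l \<otimes> y) \<preceq> rl_bot A"
      using mult_mono(1)[OF kl(4), of e] c y complementaryD(4)[OF ee'] by simp
    then have "e \<otimes> (l \<otimes> y) = rl_bot A"
      using c y by (simp add: le_bot_iff)
    then have "(l \<otimes> e) \<otimes> y \<preceq> x"
      using c x y bot_least by (simp add: m_ac)
    then have "(l \<otimes> e) \<otimes> (x \<curlyvee> y) \<preceq> x"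
      using c x y by (simp add: mult_join_le_iff mult_le)
    \<comment> \<open>this is \<open>e \<preceq> x\<close> modulo \<open>H\<close>\<close>
    then have ex: "(l \<otimes> (x \<curlyvee> y)) \<otimes> e \<preceq> x"
      using c x y by (simp add: m_ac)
    let ?m = "k \<otimes> (l \<otimes> (x \<curlyvee> y))"
    have m: "?m \<in> H"
      using filter_mult[OF H] kl xy by blast
    have "?m \<otimes> x \<preceq> k \<otimes> x" "?m \<otimes> e \<preceq> (l \<otimes> (x \<curlyvee> y)) \<otimes> e"
      using c x y by (auto intro!: mult_mono(2) mult_le)
    then have "?m \<otimes> x \<preceq> e" "?m \<otimes> e \<preceq> x"
      using kl(2) ex c x y le_trans[of "?m \<otimes> x" "k \<otimes> x" e]
        le_trans[of "?m \<otimes> e" "(l \<otimes> (x \<curlyvee> y)) \<otimes> e" x] by auto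
    then have "(x, e) \<in> filter_cong A H"
      unfolding filter_cong_iff[OF H] using x c m by blast
    then show ?thesis
      using ee' boolean_center_iff by blast
  qed
  then show "filter_has_BLP A H"
    unfolding filter_has_BLP_iff[OF H] by blast
qed

end

theorem theorem6p19:
  fixes A :: "'a residuated"
  assumes "residuated_lattice A"
  shows "has_BLP A \<longleftrightarrow> strongly_zero_dimensional (stone_topology A)"
proof -
  interpret residuated_lattice A
    by fact
  show ?thesis
    using BLP_imp_separation separation_imp_BLP strongly_zero_dimensional_iff_separation by blast
qed

end
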